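(* Let $\mathcal F$ be the free group with basis $\{a,b\}$, and let $B$ be the bouquet of two circles with edges $a,b$, so $\pi_1B=\mathcal F$. The subgroup $\mathcal H=\langle aba^{-1}b^{-1},\ a^{-1}b^{-1}ab\rangle\le\mathcal F$ is generalized echelon but is not an echelon subgroup of $\mathcal F$.
   Context: Graphs: a graph $\Gamma$ is a $1$-dimensional CW-complex with vertex set $\Gamma^0$ and edge set $\Gamma^1$ (open $1$-cells), each edge $e$ being oriented from its origin $o(e)$ to its terminus $\tau(e)$. A morphism sends vertices to vertices and edges homeomorphically to edges (compatibly with $o,\tau$); an immersion is a locally injective morphism. An immersion $\ell:H\to B$ labels the edges of $H$ by edges of $B$; $\ell(S)$ denotes the set of labels of edges in $S$. The degree of a vertex counts loops twice. $H^*$ is the set of vertices of degree $\ge3$. A finitely generated subgroup $\mathcal H\le\mathcal F$ is represented by the immersion $\ell:(H,v)\to B$ of a finite connected based graph with $\ell_*\pi_1(H,v)=\mathcal H$ obtained by wedging subdivided labelled circles reading generators of $\mathcal H$ and performing all possible foldings. Echelon: $\mathcal H\le\mathcal F$ is in echelon form with respect to an ordered free basis $X$ of $\mathcal F$ if there is an ordered basis $y_1,\dots,y_m$ of $\mathcal H$ such that each $y_i$ (as a reduced word in $X^{\pm1}$) contains at least one element of $X$ (possibly inverted) not appearing in $y_1,\dots,y_{i-1}$. $\mathcal H$ is an echelon subgroup if it is in echelon form with respect to some basis of $\mathcal F$. Reduced rank: $\widetilde{\mathrm{rank}}(\Gamma)=\sum_i\max\{0,-\chi(\Gamma_i)\}$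 over the components $\Gamma_i$ of a finite graph $\Gamma$, with $\chi(\Gamma)=|\Gamma^0|-|\Gamma^1|$. $\mathcal E\subset H^1$ is essential if $\widetilde{\mathrm{rank}}(H-\mathcal E)=\widetilde{\mathrm{rank}}(H)-|\mathcal E|$, and maximal essential if in addition $|\mathcal E|=\widetilde{\mathrm{rank}}(H)$. An arc of $H$ is a connected component of $H-H^*$. Generalized echelon: given a maximal essential set $\mathcal E=\{e_1,\dots,e_m\}$ of $H$ (listed in some order), let $A_i$ be the arc containing $e_i$, $C_i$ the connected component of $H-\bigcup_{j\ne i}A_j$ containing $e_i$, and $H_i=\bigcup_{j=1}^iC_j$. The immersion $\ell:H\to B$ is generalized echelon if $H$ has a maximal essential set $\mathcal E=\{e_1,\dots,e_m\}$ such that (1) $\ell|_{\mathcal E}$ is injective, and (2) $\ell(H_i)\cap\ell(\{e_{i+1},\dots,e_m\})=\emptyset$ for every $1\le i\le m$. A subgroup is generalized echelon if the immersion representing it is. *)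

theory Defs
  imports
    "HOL-Algebra.Generated_Groups"
    "Graph_Theory.Digraph"
    "Graph_Theory.Digraph_Component"
begin

section \<open>Words and free bases\<close>

text \<open>The letter \<open>(x, True)\<close> stands for \<open>x\<close>, the letter \<open>(x, False)\<close> for the inverse of \<open>x\<close>.\<close>

type_synonym 'g word = "('g \<times> bool) list"

definition reduced :: "'g word \<Rightarrow> bool" where
  "reduced w \<longleftrightarrow> successively (\<lambda>p q. \<not> (fst p = fst q \<and> snd p \<noteq> snd q)) w"

definition reduced_words :: "'g set \<Rightarrow> 'g word set" where
  "reduced_words X = {w. fst ` set w \<subseteq> X \<and> reduced w}"

definition letter_val :: "('g, 'r) monoid_scheme \<Rightarrow> 'g \<times> bool \<Rightarrow> 'g" where
  "letter_val F l = (if snd l then fst l else inv\<^bsub>F\<^esub> (fst l))"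

definition word_val :: "('g, 'r) monoid_scheme \<Rightarrow> 'g word \<Rightarrow> 'g" where
  "word_val F w = foldr (\<lambda>l g. letter_val F l \<otimes>\<^bsub>F\<^esub> g) w \<one>\<^bsub>F\<^esub>"

text \<open>\<open>F\<close> is free with basis \<open>X\<close>: every element is the value of exactly one reduced word in
  the elements of \<open>X\<close> and their inverses.\<close>

definition free_basis :: "('g, 'r) monoid_scheme \<Rightarrow> 'g set \<Rightarrow> bool" where
  "free_basis F X \<longleftrightarrow>
     group F \<and> X \<subseteq> carrier F \<and> bij_betw (word_val F) (reduced_words X) (carrier F)"

definition reduced_word_of :: "('g, 'r) monoid_scheme \<Rightarrow> 'g set \<Rightarrow> 'g \<Rightarrow> 'g word" where
  "reduced_word_of F X g = (THE w. w \<in> reduced_words X \<and> word_val F w = g)"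

definition basis_support :: "('g, 'r) monoid_scheme \<Rightarrow> 'g set \<Rightarrow> 'g \<Rightarrow> 'g set" where
  "basis_support F X g = fst ` set (reduced_word_of F X g)"


section \<open>Echelon subgroups\<close>

text \<open>The condition does not depend on the order of the ambient basis \<open>X\<close>, so \<open>X\<close> is a set
  here; the order of the basis \<open>ys\<close> of the subgroup \<open>H\<close> matters.\<close>

definition echelon_form :: "('g, 'r) monoid_scheme \<Rightarrow> 'g set \<Rightarrow> 'g set \<Rightarrow> bool" where
  "echelon_form F X H \<longleftrightarrow>
     free_basis F X \<and> subgroup H F \<and>
     (\<exists>ys. distinct ys \<and> free_basis (F\<lparr>carrier := H\<rparr>) (set ys) \<and>
        (\<forall>i < length ys.
           \<exists>x \<in> basis_support F X (ys ! i). \<forall>j < i. x \<notin> basis_support F X (ys ! j)))"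

definition echelon_subgroup :: "('g, 'r) monoid_scheme \<Rightarrow> 'g set \<Rightarrow> bool" where
  "echelon_subgroup F H \<longleftrightarrow> (\<exists>X. echelon_form F X H)"


section \<open>Graphs as cell complexes\<close>

text \<open>A graph is a \<open>pre_digraph\<close> with the orientation of the 1-cells given by \<open>tail\<close> and
  \<open>head\<close>. A union of cells is encoded as a set of vertices \<open>Inl v\<close> and open edges \<open>Inr e\<close>; it
  need not be a subgraph. Topological connectivity of such a union is generated by incidences
  between an edge and an end vertex that both lie in the union: two open edges do not touch
  unless a common end vertex is present.\<close>

definition cells :: "('v, 'e) pre_digraph \<Rightarrow> ('v + 'e) set" where
  "cells G = Inl ` verts G \<union> Inr ` arcs G"

definition incidence :: "('v, 'e) pre_digraph \<Rightarrow> ('v + 'e) rel" where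
  "incidence G =
     (\<Union>e \<in> arcs G. {(Inl (tail G e), Inr e), (Inr e, Inl (tail G e)),
                     (Inl (head G e), Inr e), (Inr e, Inl (head G e))})"

definition cell_connected :: "('v, 'e) pre_digraph \<Rightarrow> ('v + 'e) set \<Rightarrow> ('v + 'e) rel" where
  "cell_connected G S = (incidence G \<inter> S \<times> S)\<^sup>* \<inter> S \<times> S"

definition components :: "('v, 'e) pre_digraph \<Rightarrow> ('v + 'e) set \<Rightarrow> ('v + 'e) set set" where
  "components G S = S // cell_connected G S"

definition component_of ::
    "('v, 'e) pre_digraph \<Rightarrow> ('v + 'e) set \<Rightarrow> ('v + 'e) \<Rightarrow> ('v + 'e) set" where
  "component_of G S c = cell_connected G S `` {c}"

definition euler_char :: "('v + 'e) set \<Rightarrow> int" where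
  "euler_char S = int (card (Inl -` S)) - int (card (Inr -` S))"

definition reduced_rank :: "('v, 'e) pre_digraph \<Rightarrow> ('v + 'e) set \<Rightarrow> int" where
  "reduced_rank G S = (\<Sum>K \<in> components G S. max 0 (- euler_char K))"

definition essential :: "('v, 'e) pre_digraph \<Rightarrow> 'e set \<Rightarrow> bool" where
  "essential G E \<longleftrightarrow>
     E \<subseteq> arcs G \<and>
     reduced_rank G (cells G - Inr ` E) = reduced_rank G (cells G) - int (card E)"

definition maximal_essential :: "('v, 'e) pre_digraph \<Rightarrow> 'e set \<Rightarrow> bool" where
  "maximal_essential G E \<longleftrightarrow> essential G E \<and> int (card E) = reduced_rank G (cells G)"

definition branch_vertices :: "('v, 'e) pre_digraph \<Rightarrow> 'v set" where
  "branch_vertices G = {v \<in> verts G. in_degree G v + out_degree G v \<ge> 3}"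

definition arc_containing :: "('v, 'e) pre_digraph \<Rightarrow> 'e \<Rightarrow> ('v + 'e) set" where
  "arc_containing G e = component_of G (cells G - Inl ` branch_vertices G) (Inr e)"


section \<open>Morphisms, immersions and the generalized echelon property\<close>

definition graph_morphism ::
    "('v, 'e) pre_digraph \<Rightarrow> ('w, 'l) pre_digraph \<Rightarrow> ('v \<Rightarrow> 'w) \<Rightarrow> ('e \<Rightarrow> 'l) \<Rightarrow> bool" where
  "graph_morphism G B fv fe \<longleftrightarrow>
     wf_digraph G \<and> wf_digraph B \<and>
     (\<forall>v \<in> verts G. fv v \<in> verts B) \<and>
     (\<forall>e \<in> arcs G. fe e \<in> arcs B \<and> tail B (fe e) = fv (tail G e) \<and> head B (fe e) = fv (head G e))"

text \<open>Local injectivity: a morphism preserves orientations, so only two outgoing or two incoming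
  half-edges at a vertex can have the same image.\<close>

definition immersion ::
    "('v, 'e) pre_digraph \<Rightarrow> ('w, 'l) pre_digraph \<Rightarrow> ('v \<Rightarrow> 'w) \<Rightarrow> ('e \<Rightarrow> 'l) \<Rightarrow> bool" where
  "immersion G B fv fe \<longleftrightarrow>
     graph_morphism G B fv fe \<and>
     (\<forall>v \<in> verts G. inj_on fe (out_arcs G v) \<and> inj_on fe (in_arcs G v))"

definition labels :: "('e \<Rightarrow> 'l) \<Rightarrow> ('v + 'e) set \<Rightarrow> 'l set" where
  "labels fe S = fe ` (Inr -` S)"

text \<open>The piece \<open>C\<^sub>i\<close>: the component containing the \<open>i\<close>-th edge after all arcs of the
  other listed edges have been removed. Lists are indexed from 0.\<close>

definition echelon_piece :: "('v, 'e) pre_digraph \<Rightarrow> 'e list \<Rightarrow> nat \<Rightarrow> ('v + 'e) set" where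
  "echelon_piece G es i =
     component_of G
       (cells G - (\<Union>j \<in> {..<length es} - {i}. arc_containing G (es ! j))) (Inr (es ! i))"

definition generalized_echelon_immersion ::
    "('v, 'e) pre_digraph \<Rightarrow> ('w, 'l) pre_digraph \<Rightarrow> ('v \<Rightarrow> 'w) \<Rightarrow> ('e \<Rightarrow> 'l) \<Rightarrow> bool" where
  "generalized_echelon_immersion G B fv fe \<longleftrightarrow>
     fin_digraph G \<and> immersion G B fv fe \<and>
     (\<exists>es. distinct es \<and> maximal_essential G (set es) \<and>
        inj_on fe (set es) \<and>
        (\<forall>i < length es.
           labels fe (\<Union>j \<in> {..i}. echelon_piece G es j) \<inter> fe ` set (drop (Suc i) es) = {}))"


section \<open>The immersion representing a subgroup\<close>

definition bouquet :: "'g set \<Rightarrow> (unit, 'g) pre_digraph" where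
  "bouquet X = \<lparr>verts = {()}, arcs = X, tail = (\<lambda>_. ()), head = (\<lambda>_. ())\<rparr>"

text \<open>Edge paths; \<open>(e, True)\<close> traverses \<open>e\<close> along its orientation, \<open>(e, False)\<close> against it.\<close>

fun edge_path :: "('v, 'e) pre_digraph \<Rightarrow> 'v \<Rightarrow> ('e \<times> bool) list \<Rightarrow> 'v \<Rightarrow> bool" where
  "edge_path G u [] v \<longleftrightarrow> u \<in> verts G \<and> u = v"
| "edge_path G u ((e, s) # p) v \<longleftrightarrow>
     e \<in> arcs G \<and> u = (if s then tail G e else head G e) \<and>
     edge_path G (if s then head G e else tail G e) p v"

text \<open>The image of the fundamental group at \<open>v\<close> in the fundamental group \<open>F\<close> of the bouquet.
  Every class of loops at \<open>v\<close> contains a closed edge path, and the value of its label depends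
  only on the class.\<close>

definition pi1_image ::
    "('g, 'r) monoid_scheme \<Rightarrow> ('v, 'e) pre_digraph \<Rightarrow> 'v \<Rightarrow> ('e \<Rightarrow> 'g) \<Rightarrow> 'g set" where
  "pi1_image F G v fe =
     {word_val F (map (\<lambda>(e, s). (fe e, s)) p) | p. edge_path G v p v}"

text \<open>The wedge at \<open>(0, 0)\<close> of circles reading the words \<open>ws\<close>. The circle of the \<open>i\<close>-th word has
  the edges \<open>(i, k)\<close>, one for each letter, and the subdivision vertices \<open>(i, k)\<close> with
  \<open>0 < k < length (ws ! i)\<close>. The edge of a letter \<open>(x, False)\<close> is oriented against the direction
  of reading.\<close>

definition wedge_vertex :: "'g word list \<Rightarrow> nat \<Rightarrow> nat \<Rightarrow> nat \<times> nat" where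
  "wedge_vertex ws i k = (if k = 0 \<or> k = length (ws ! i) then (0, 0) else (i, k))"

definition wedge :: "'g word list \<Rightarrow> (nat \<times> nat, nat \<times> nat) pre_digraph" where
  "wedge ws =
     \<lparr>verts = insert (0, 0) {(i, k). i < length ws \<and> 0 < k \<and> k < length (ws ! i)},
      arcs = {(i, k). i < length ws \<and> k < length (ws ! i)},
      tail = (\<lambda>(i, k). wedge_vertex ws i (if snd (ws ! i ! k) then k else Suc k)),
      head = (\<lambda>(i, k). wedge_vertex ws i (if snd (ws ! i ! k) then Suc k else k))\<rparr>"

definition wedge_label :: "'g word list \<Rightarrow> nat \<times> nat \<Rightarrow> 'g" where
  "wedge_label ws = (\<lambda>(i, k). fst (ws ! i ! k))"

text \<open>Folding identifies two edges with the same label and the same origin (or terminus): the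
  edge \<open>e'\<close> is deleted and its other end vertex is merged into that of \<open>e\<close>.\<close>

definition merge_vertex :: "'v \<Rightarrow> 'v \<Rightarrow> 'v \<Rightarrow> 'v" where
  "merge_vertex u u' = (\<lambda>x. if x = u' then u else x)"

definition fold_graph ::
    "('v, 'e) pre_digraph \<Rightarrow> 'e \<Rightarrow> ('v \<Rightarrow> 'v) \<Rightarrow> ('v, 'e) pre_digraph" where
  "fold_graph G e' q =
     \<lparr>verts = q ` verts G, arcs = arcs G - {e'}, tail = q \<circ> tail G, head = q \<circ> head G\<rparr>"

inductive fold_step ::
    "('e \<Rightarrow> 'l) \<Rightarrow> ('v, 'e) pre_digraph \<times> 'v \<Rightarrow> ('v, 'e) pre_digraph \<times> 'v \<Rightarrow> bool"
  for fe where
  same_tail: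
    "\<lbrakk>e \<in> arcs G; e' \<in> arcs G; e \<noteq> e'; fe e = fe e'; tail G e = tail G e';
      q = merge_vertex (head G e) (head G e')\<rbrakk>
     \<Longrightarrow> fold_step fe (G, v) (fold_graph G e' q, q v)"
| same_head:
    "\<lbrakk>e \<in> arcs G; e' \<in> arcs G; e \<noteq> e'; fe e = fe e'; head G e = head G e';
      q = merge_vertex (tail G e) (tail G e')\<rbrakk>
     \<Longrightarrow> fold_step fe (G, v) (fold_graph G e' q, q v)"

text \<open>That no further folding is possible is expressed by the labelling being an immersion. The
  based labelled graph obtained is unique up to isomorphism: it does not depend on the chosen
  generators, nor on the order of the foldings.\<close>

definition represents ::
    "('g, 'r) monoid_scheme \<Rightarrow> 'g set \<Rightarrow> 'g set \<Rightarrow>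
     (nat \<times> nat, nat \<times> nat) pre_digraph \<Rightarrow> nat \<times> nat \<Rightarrow> (nat \<times> nat \<Rightarrow> 'g) \<Rightarrow> bool" where
  "represents F X H G v fe \<longleftrightarrow>
     fin_digraph G \<and> connected G \<and> v \<in> verts G \<and>
     immersion G (bouquet X) (\<lambda>_. ()) fe \<and>
     pi1_image F G v fe = H \<and>
     (\<exists>ws. set ws \<subseteq> reduced_words X \<and> generate F (word_val F ` set ws) = H \<and>
        fe = wedge_label ws \<and> (fold_step fe)\<^sup>*\<^sup>* (wedge ws, (0, 0)) (G, v))"

definition generalized_echelon_subgroup ::
    "('g, 'r) monoid_scheme \<Rightarrow> 'g set \<Rightarrow> 'g set \<Rightarrow> bool" where
  "generalized_echelon_subgroup F X H \<longleftrightarrow>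
     (\<exists>G v fe. represents F X H G v fe \<and>
        generalized_echelon_immersion G (bouquet X) (\<lambda>_. ()) fe)"

end

theory Submission
  imports Defs
begin

text \<open>The wedge of the circles reading \<open>aba\<^sup>-\<^sup>1b\<^sup>-\<^sup>1\<close> and \<open>a\<^sup>-\<^sup>1b\<^sup>-\<^sup>1ab\<close> is already folded and has
  reduced rank 1, so a single edge is a maximal essential set and the conditions on labels are
  vacuous. Conversely, every basis \<open>X\<close> of \<open>F\<close> has at most two elements and \<open>H\<close> is not
  abelian. In an echelon form the first basis element of \<open>H\<close> therefore misses an element of
  \<open>X\<close>, so it is a nontrivial power of the other one. But \<open>H\<close> lies in the commutator
  subgroup, on which all exponent sums vanish.\<close>


section \<open>Words in a group\<close>

lemma reduced_Cons:
  "reduced (p # w) \<longleftrightarrow> w = [] \<or> \<not> (fst p = fst (hd w) \<and> snd p \<noteq> snd (hd w)) \<and> reduced w"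
  by (cases w) (auto simp: reduced_def)

lemma word_val_Nil [simp]: "word_val G [] = \<one>\<^bsub>G\<^esub>"
  and word_val_Cons [simp]: "word_val G (l # w) = letter_val G l \<otimes>\<^bsub>G\<^esub> word_val G w"
  by (simp_all add: word_val_def)

context group
begin

lemma letter_val_closed [simp]: "fst l \<in> carrier G \<Longrightarrow> letter_val G l \<in> carrier G"
  by (simp add: letter_val_def)

lemma letter_val_opposite: "x \<in> carrier G \<Longrightarrow> letter_val G (x, \<not> s) = inv (letter_val G (x, s))"
  by (simp add: letter_val_def)

lemma word_val_closed [simp]: "fst ` set w \<subseteq> carrier G \<Longrightarrow> word_val G w \<in> carrier G"
  by (induction w) auto

lemma word_val_append:
  "fst ` set u \<subseteq> carrier G \<Longrightarrow> fst ` set w \<subseteq> carrier G \<Longrightarrow>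
    word_val G (u @ w) = word_val G u \<otimes> word_val G w"
  by (induction u) (auto simp: m_assoc)

lemma word_val_inverse:
  "fst ` set w \<subseteq> carrier G \<Longrightarrow>
    word_val G (rev (map (\<lambda>(x, s). (x, \<not> s)) w)) = inv (word_val G w)"
proof (induction w)
  case (Cons l w)
  obtain x s where l: "l = (x, s)" by fastforce
  have "fst ` set (rev (map (\<lambda>(x, s). (x, \<not> s)) w)) \<subseteq> carrier G"
    using Cons.prems by force
  then show ?case
    using Cons by (simp add: l word_val_append letter_val_opposite inv_mult_group)
qed simp

lemma word_val_in_subgroup:
  assumes "subgroup H G" "fst ` set w \<subseteq> H"
  shows "word_val G w \<in> H"
  using assms(2)
  by (induction w)
    (use assms(1) in \<open>auto simp: letter_val_def intro: subgroup.m_closed subgroup.m_inv_closed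
       subgroup.one_closed\<close>)

text \<open>Since this is a subgroup, an element that commutes with generators commutes with every
  word in them.\<close>

lemma centralizer_subgroup:
  assumes "x \<in> carrier G"
  shows "subgroup {g \<in> carrier G. x \<otimes> g = g \<otimes> x} G"
proof (rule subgroupI)
  fix g assume "g \<in> {g \<in> carrier G. x \<otimes> g = g \<otimes> x}"
  then have g: "g \<in> carrier G" "x \<otimes> g = g \<otimes> x" by auto
  \<comment> \<open>Inserting \<open>inv g \<otimes> g\<close> in front of \<open>x\<close> exposes
    \<open>g \<otimes> x\<close>, which can then be replaced by
    \<open>x \<otimes> g\<close>.\<close>
  have "x \<otimes> inv g = inv g \<otimes> (g \<otimes> x) \<otimes> inv g"
    using assms g(1) by (simp add: m_assoc[symmetric])
  also have "\<dots> = inv g \<otimes> x"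
    using assms g(1) by (simp add: g(2)[symmetric] m_assoc)
  finally show "inv g \<in> {g \<in> carrier G. x \<otimes> g = g \<otimes> x}"
    using g by simp
next
  fix g h assume "g \<in> {g \<in> carrier G. x \<otimes> g = g \<otimes> x}" "h \<in> {g \<in> carrier G. x \<otimes> g = g \<otimes> x}"
  then show "g \<otimes> h \<in> {g \<in> carrier G. x \<otimes> g = g \<otimes> x}"
    using assms by (metis (mono_tags, lifting) m_assoc m_closed mem_Collect_eq)
qed (use assms in auto)

end

text \<open>The centralizer argument runs twice: the only possible basis element commutes with
  itself, hence with everything; so every element commutes with the basis, hence with everything.
  The inclusion \<open>Y \<subseteq> {y}\<close> also covers the empty basis of the trivial
  group.\<close>

lemma free_basis_singleton_comm:
  assumes "free_basis G Y" "Y \<subseteq> {y}" "g \<in> carrier G" "h \<in> carrier G"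
  shows "g \<otimes>\<^bsub>G\<^esub> h = h \<otimes>\<^bsub>G\<^esub> g"
proof -
  interpret group G using assms(1) by (simp add: free_basis_def)
  have Y: "Y \<subseteq> carrier G" using assms(1) by (simp add: free_basis_def)
  have words: "\<exists>w. fst ` set w \<subseteq> Y \<and> g = word_val G w" if "g \<in> carrier G" for g
    using assms(1) that by (fastforce simp: free_basis_def bij_betw_def reduced_words_def)
  have *: "x \<otimes>\<^bsub>G\<^esub> g = g \<otimes>\<^bsub>G\<^esub> x"
    if x: "x \<in> carrier G" "\<And>y. y \<in> Y \<Longrightarrow> x \<otimes>\<^bsub>G\<^esub> y = y \<otimes>\<^bsub>G\<^esub> x" and g: "g \<in> carrier G" for x g
  proof -
    obtain w where w: "fst ` set w \<subseteq> Y" "g = word_val G w"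
      using words[OF g] by blast
    then have "g \<in> {g \<in> carrier G. x \<otimes>\<^bsub>G\<^esub> g = g \<otimes>\<^bsub>G\<^esub> x}"
      using word_val_in_subgroup[OF centralizer_subgroup[OF x(1)], of w] x(2) Y by blast
    then show ?thesis by simp
  qed
  have y: "y' \<otimes>\<^bsub>G\<^esub> g = g \<otimes>\<^bsub>G\<^esub> y'" if "y' \<in> Y" "g \<in> carrier G" for y' g
    using * that Y assms(2) by blast
  show ?thesis
    using * y assms(3,4) Y by metis
qed


section \<open>Exponent sums in a free group\<close>

text \<open>The weight is arbitrary because two kinds are needed: the constant 1 and the indicator
  functions of subsets of a basis.\<close>

definition word_sum :: "('g \<Rightarrow> int) \<Rightarrow> 'g word \<Rightarrow> int" where
  "word_sum f w = (\<Sum>l\<leftarrow>w. if snd l then f (fst l) else - f (fst l))"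

lemma word_sum_simps [simp]:
  "word_sum f [] = 0"
  "word_sum f (l # w) = (if snd l then f (fst l) else - f (fst l)) + word_sum f w"
  "word_sum f (u @ w) = word_sum f u + word_sum f w"
  by (simp_all add: word_sum_def)

text \<open>When \<open>X\<close> is a free basis, this is the homomorphism to the integers that
  extends the restriction of \<open>f\<close> to \<open>X\<close>.\<close>

definition exponent_sum ::
    "('g, 'r) monoid_scheme \<Rightarrow> 'g set \<Rightarrow> ('g \<Rightarrow> int) \<Rightarrow> 'g \<Rightarrow> int" where
  "exponent_sum G X f g = word_sum f (reduced_word_of G X g)"

text \<open>A letter put in front of a reduced word either keeps it reduced or cancels against its
  head. Cancelling letters have opposite signs, so neither the value nor any weighted sum changes,
  and one \<open>w'\<close> serves all weights.\<close>

lemma (in group) exists_reduced_word: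
  assumes "X \<subseteq> carrier G" "fst ` set w \<subseteq> X"
  shows "\<exists>w' \<in> reduced_words X. word_val G w' = word_val G w \<and> (\<forall>f. word_sum f w' = word_sum f w)"
  using assms(2)
proof (induction w)
  case Nil
  then show ?case by (intro bexI[of _ "[]"]) (auto simp: reduced_words_def reduced_def)
next
  case (Cons l w)
  then obtain w' where w': "w' \<in> reduced_words X" "word_val G w' = word_val G w"
    "\<And>f. word_sum f w' = word_sum f w" by auto
  have l: "fst l \<in> X" using Cons.prems by simp
  show ?case
  proof (cases "reduced (l # w')")
    case True
    then show ?thesis
      using w' l by (intro bexI[of _ "l # w'"]) (auto simp: reduced_words_def)
  next
    case False
    then obtain l' v where v: "w' = l' # v" "fst l = fst l'" "snd l' = (\<not> snd l)"
      using w'(1) by (cases w') (auto simp: reduced_Cons reduced_words_def)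
    have X: "fst l \<in> carrier G" using l assms(1) by blast
    have v_in: "v \<in> reduced_words X"
      using w'(1) by (auto simp: v reduced_words_def reduced_Cons) (simp add: reduced_def)
    then have "fst ` set v \<subseteq> carrier G" using assms(1) by (auto simp: reduced_words_def)
    moreover have "letter_val G l' = inv (letter_val G l)"
      using letter_val_opposite[OF X, of "snd l"] v(2,3) by (cases l; cases l') simp
    ultimately have "word_val G (l # w) = word_val G v"
      using X by (simp add: w'(2)[symmetric] v(1) m_assoc[symmetric])
    moreover have "word_sum f (l # w) = word_sum f v" for f
      using v by (simp add: w'(3)[symmetric])
    ultimately show ?thesis using v_in by metis
  qed
qed

lemma reduced_word_of_word_val:
  assumes "free_basis G X" "w \<in> reduced_words X"
  shows "reduced_word_of G X (word_val G w) = w"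
  unfolding reduced_word_of_def
  using assms by (intro the_equality) (auto simp: free_basis_def bij_betw_def inj_on_def)

lemma reduced_word_of:
  assumes "free_basis G X" "g \<in> carrier G"
  shows "reduced_word_of G X g \<in> reduced_words X" "word_val G (reduced_word_of G X g) = g"
proof -
  obtain w where "w \<in> reduced_words X" "word_val G w = g"
    using assms unfolding free_basis_def bij_betw_def by (metis imageE)
  then show "reduced_word_of G X g \<in> reduced_words X" "word_val G (reduced_word_of G X g) = g"
    using reduced_word_of_word_val[OF assms(1)] by auto
qed

text \<open>Cancellation preserves both the value and the sum, so the exponent sum can be computed
  from any word in \<open>X\<close>, reduced or not.\<close>

lemma exponent_sum_word_val:
  assumes "free_basis G X" "fst ` set w \<subseteq> X"
  shows "exponent_sum G X f (word_val G w) = word_sum f w"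
proof -
  interpret group G using assms(1) by (simp add: free_basis_def)
  have "X \<subseteq> carrier G" using assms(1) by (simp add: free_basis_def)
  from exists_reduced_word[OF this assms(2)] obtain w'
    where "w' \<in> reduced_words X" "word_val G w' = word_val G w" "word_sum f w' = word_sum f w"
    by metis
  then show ?thesis
    using reduced_word_of_word_val[OF assms(1)] by (metis exponent_sum_def)
qed

lemma exponent_sum_basis:
  assumes "free_basis G X" "x \<in> X"
  shows "exponent_sum G X f x = f x"
proof -
  interpret group G using assms(1) by (simp add: free_basis_def)
  have "x \<in> carrier G" using assms by (auto simp: free_basis_def)
  then show ?thesis
    using exponent_sum_word_val[OF assms(1), of "[(x, True)]" f] assms(2)
    by (simp add: letter_val_def)
qed

lemma exponent_sum_one: "free_basis G X \<Longrightarrow> exponent_sum G X f \<one>\<^bsub>G\<^esub> = 0"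
  using exponent_sum_word_val[of G X "[]"] by simp

lemma exponent_sum_mult:
  assumes "free_basis G X" "g \<in> carrier G" "h \<in> carrier G"
  shows "exponent_sum G X f (g \<otimes>\<^bsub>G\<^esub> h) = exponent_sum G X f g + exponent_sum G X f h"
proof -
  interpret group G using assms(1) by (simp add: free_basis_def)
  let ?u = "reduced_word_of G X g" and ?w = "reduced_word_of G X h"
  have X: "X \<subseteq> carrier G" using assms(1) by (simp add: free_basis_def)
  have u: "fst ` set ?u \<subseteq> X" "fst ` set ?w \<subseteq> X"
    using reduced_word_of(1)[OF assms(1)] assms by (auto simp: reduced_words_def)
  \<comment> \<open>The concatenation need not be reduced; \<open>exponent_sum_word_val\<close>
    applies to it all the same.\<close>
  have "word_val G (?u @ ?w) = g \<otimes>\<^bsub>G\<^esub> h"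
    using u X reduced_word_of(2)[OF assms(1)] assms(2,3) by (subst word_val_append) auto
  then show ?thesis
    using exponent_sum_word_val[OF assms(1), of "?u @ ?w" f] u
    by (simp add: exponent_sum_def image_Un)
qed

lemma exponent_sum_inv:
  assumes "free_basis G X" "g \<in> carrier G"
  shows "exponent_sum G X f (inv\<^bsub>G\<^esub> g) = - exponent_sum G X f g"
proof -
  interpret group G using assms(1) by (simp add: free_basis_def)
  show ?thesis
    using exponent_sum_mult[OF assms(1), of g "inv\<^bsub>G\<^esub> g" f] exponent_sum_one[OF assms(1), of f] assms(2)
    by simp
qed

lemma exponent_sum_eq_0_subgroup:
  assumes "free_basis G X"
  shows "subgroup {g \<in> carrier G. exponent_sum G X f g = 0} G"
proof -
  interpret group G using assms(1) by (simp add: free_basis_def)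
  show ?thesis
    using assms exponent_sum_one[OF assms]
    by (intro subgroupI) (auto simp: exponent_sum_mult exponent_sum_inv)
qed

text \<open>Modulo 2 a sum is a difference, so this is the set where two homomorphisms have equal
  parity.\<close>

lemma even_exponent_sum_subgroup:
  assumes "free_basis G X"
  shows "subgroup {g \<in> carrier G. even (exponent_sum G X f g + exponent_sum G X f' g)} G"
proof -
  interpret group G using assms(1) by (simp add: free_basis_def)
  show ?thesis
    using assms exponent_sum_one[OF assms]
    by (intro subgroupI) (auto simp: exponent_sum_mult exponent_sum_inv)
qed

text \<open>A subset of \<open>X\<close> is determined by the parities of its exponent sums on \<open>a\<close> and
  \<open>b\<close>, so \<open>X\<close> has at most \<open>2\<^sup>2\<close> subsets.\<close>

lemma free_basis_card_le_2:
  assumes ab: "free_basis G {a, b}" and X: "free_basis G X"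
  shows "finite X" "card X \<le> 2"
proof -
  interpret group G using X by (simp add: free_basis_def)
  \<comment> \<open>The homomorphism sending the basis elements in \<open>S\<close> to 1 and the
    other basis elements to 0.\<close>
  let ?\<phi> = "\<lambda>S. exponent_sum G X (of_bool \<circ> (\<lambda>x. x \<in> S))"
  let ?f = "\<lambda>S. (even (?\<phi> S a), even (?\<phi> S b))"
  have inj: "inj_on ?f (Pow X)"
  proof (rule inj_onI)
    fix S T assume S: "S \<in> Pow X" "T \<in> Pow X" and eq: "?f S = ?f T"
    \<comment> \<open>The subgroup on which both parities agree contains \<open>a\<close> and
      \<open>b\<close>, hence is the whole group.\<close>
    let ?K = "{g \<in> carrier G. even (?\<phi> S g + ?\<phi> T g)}"
    have "{a, b} \<subseteq> ?K" using eq ab by (auto simp: free_basis_def)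
    moreover have "subgroup ?K G" by (rule even_exponent_sum_subgroup[OF X])
    ultimately have "word_val G w \<in> ?K" if "w \<in> reduced_words {a, b}" for w
      using that word_val_in_subgroup[of ?K w] by (auto simp: reduced_words_def)
    then have "word_val G ` reduced_words {a, b} \<subseteq> ?K" by blast
    then have K: "carrier G \<subseteq> ?K"
      using ab by (simp add: free_basis_def bij_betw_def)
    \<comment> \<open>At a basis element the parity of \<open>?\<phi> S\<close> records membership
      in \<open>S\<close>, so agreeing parities recover the set.\<close>
    have "x \<in> S \<longleftrightarrow> x \<in> T" if x: "x \<in> X" for x
    proof -
      have "x \<in> carrier G" using X x by (auto simp: free_basis_def)
      with K have "even (?\<phi> S x + ?\<phi> T x)" by blast
      then show ?thesis
        by (cases "x \<in> S"; cases "x \<in> T") (simp_all add: exponent_sum_basis[OF X x])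
    qed
    then show "S = T" using S by blast
  qed
  \<comment> \<open>Finiteness of \<open>X\<close> is obtained here, from an injection of
    \<open>Pow X\<close> into the finite type \<open>bool \<times> bool\<close>.\<close>
  have "finite (?f ` Pow X)" by (rule finite)
  then have fin: "finite (Pow X)" using inj by (rule finite_imageD)
  then show "finite X" by simp
  have "card (Pow X) \<le> card (UNIV :: (bool \<times> bool) set)"
    using inj by (intro card_inj_on_le[of ?f]) auto
  also have "\<dots> = 2 ^ 2" by (simp add: card_UNIV_bool card_cartesian_product flip: UNIV_Times_UNIV)
  finally show "card X \<le> 2"
    using \<open>finite X\<close> power_le_imp_le_exp[of "2::nat" "card X" 2] by (simp add: card_Pow)
qed

text \<open>A reduced word in one letter cannot change sign, so it is a power of \<open>x\<close>
  whose exponent is plus or minus its length.\<close>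

lemma word_sum_single_letter:
  assumes "reduced w" "fst ` set w \<subseteq> {x}" "w \<noteq> []"
  shows "word_sum (\<lambda>_. 1) w \<noteq> 0"
proof -
  have "word_sum (\<lambda>_. 1) w = (if snd (hd w) then int (length w) else - int (length w))"
    using assms
  proof (induction w)
    case (Cons l w)
    show ?case
    proof (cases "w = []")
      case False
      then have "fst l = fst (hd w)" using Cons.prems(2) by (cases w) auto
      with False Cons.prems(1) have "snd l = snd (hd w)" "reduced w"
        unfolding reduced_Cons by auto
      with Cons False show ?thesis by simp
    qed simp
  qed simp
  then show ?thesis using assms(3) by simp
qed


section \<open>Echelon subgroups of a free group of rank two\<close>

text \<open>An echelon form may use any basis of the ambient group, so \<open>comm\<close>
  quantifies over all of them; it is how containment in the commutator subgroup enters.\<close>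

lemma not_echelon_subgroup:
  assumes ab: "free_basis G {a, b}"
    and comm: "\<And>X f. free_basis G X \<Longrightarrow> H \<subseteq> {g \<in> carrier G. exponent_sum G X f g = 0}"
    and noncomm: "g \<in> H" "h \<in> H" "g \<otimes>\<^bsub>G\<^esub> h \<noteq> h \<otimes>\<^bsub>G\<^esub> g"
  shows "\<not> echelon_subgroup G H"
proof
  assume "echelon_subgroup G H"
  then obtain X ys where X: "free_basis G X" and ys: "distinct ys"
    "free_basis (G\<lparr>carrier := H\<rparr>) (set ys)"
    and ech: "\<And>i. i < length ys \<Longrightarrow>
      \<exists>x \<in> basis_support G X (ys ! i). \<forall>j < i. x \<notin> basis_support G X (ys ! j)"
    unfolding echelon_subgroup_def echelon_form_def by blast
  have len: "1 < length ys"
  proof (rule ccontr)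
    assume "\<not> 1 < length ys"
    then obtain y where "set ys \<subseteq> {y}"
      by (cases ys) auto
    with ys(2) noncomm show False
      using free_basis_singleton_comm[of "G\<lparr>carrier := H\<rparr>" "set ys" y g h] by simp
  qed
  let ?w = "reduced_word_of G X (ys ! 0)"
  have "set ys \<subseteq> H" using ys(2) by (simp add: free_basis_def)
  moreover have "ys ! 0 \<in> set ys" "ys ! 1 \<in> set ys"
    using len by (auto intro: nth_mem simp del: length_greater_0_conv)
  ultimately have y0: "ys ! 0 \<in> H" "ys ! 1 \<in> H" by blast+
  then have y0_in: "ys ! 0 \<in> carrier G" "ys ! 1 \<in> carrier G"
    using comm[OF X] by blast+
  \<comment> \<open>At index 0 the echelon condition only says that the support is nonempty; at
    index 1 it gives a \<open>z\<close> outside the first support, so \<open>z\<close> differs from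
    \<open>x\<close>.\<close>
  obtain x z where x: "x \<in> basis_support G X (ys ! 0)"
    and z: "z \<in> basis_support G X (ys ! 1)" "z \<notin> basis_support G X (ys ! 0)"
    using ech[of 0] ech[of 1] len by fastforce
  have supp: "basis_support G X (ys ! 0) \<subseteq> X" "basis_support G X (ys ! 1) \<subseteq> X"
    using reduced_word_of(1)[OF X] y0_in by (auto simp: basis_support_def reduced_words_def)
  \<comment> \<open>As \<open>X\<close> has at most two elements, \<open>x\<close> and
    \<open>z\<close> exhaust it; since \<open>z\<close> does not occur in \<open>?w\<close>, only
    \<open>x\<close> does.\<close>
  have "{x, z} = X"
  proof (rule card_seteq)
    show "card X \<le> card {x, z}"
      using x z(2) free_basis_card_le_2(2)[OF ab X] by (cases "x = z") auto
  qed (use free_basis_card_le_2(1)[OF ab X] x z supp in auto)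
  then have "fst ` set ?w \<subseteq> {x}"
    using supp(1) z(2) by (auto simp: basis_support_def)
  moreover have "?w \<noteq> []" using x by (auto simp: basis_support_def)
  moreover have "reduced ?w"
    using reduced_word_of(1)[OF X y0_in(1)] by (simp add: reduced_words_def)
  ultimately have "exponent_sum G X (\<lambda>_. 1) (ys ! 0) \<noteq> 0"
    unfolding exponent_sum_def by (intro word_sum_single_letter)
  then show False using comm[OF X] y0(1) by blast
qed


section \<open>Wedges of labelled circles\<close>

lemma wedge_sel [simp]:
  "verts (wedge ws) = insert (0, 0) {(i, k). i < length ws \<and> 0 < k \<and> k < length (ws ! i)}"
  "arcs (wedge ws) = {(i, k). i < length ws \<and> k < length (ws ! i)}"
  "tail (wedge ws) (i, k) = wedge_vertex ws i (if snd (ws ! i ! k) then k else Suc k)"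
  "head (wedge ws) (i, k) = wedge_vertex ws i (if snd (ws ! i ! k) then Suc k else k)"
  by (simp_all add: wedge_def)

lemma wedge_vertex_in_verts:
  "i < length ws \<Longrightarrow> k \<le> length (ws ! i) \<Longrightarrow> wedge_vertex ws i k \<in> verts (wedge ws)"
  by (auto simp: wedge_vertex_def)

lemma wedge_vertex_cases:
  assumes "v \<in> verts (wedge ws)"
  obtains "v = (0, 0)"
  | i k where "i < length ws" "k < length (ws ! i)" "v = wedge_vertex ws i k"
  using assms by (auto simp: wedge_vertex_def)

lemma fin_digraph_wedge: "fin_digraph (wedge ws)"
proof
  have *: "finite (SIGMA i:{..<length ws}. {..<length (ws ! i)})" by simp
  show "finite (verts (wedge ws))" "finite (arcs (wedge ws))"
    by (auto intro: finite_subset[OF _ *])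
next
  fix e assume "e \<in> arcs (wedge ws)"
  then obtain i k where "e = (i, k)" "i < length ws" "k < length (ws ! i)" by auto
  then show "tail (wedge ws) e \<in> verts (wedge ws)" "head (wedge ws) e \<in> verts (wedge ws)"
    using wedge_vertex_in_verts[of i ws k] wedge_vertex_in_verts[of i ws "Suc k"]
    by (auto simp del: wedge_sel(1))
qed

text \<open>\<open>connected\<close> refers to the symmetric closure, so orientations are ignored:
  following each circle from the base point reaches every vertex, and symmetry supplies the way
  back.\<close>

lemma connected_wedge: "connected (wedge ws)"
proof -
  interpret fin_digraph "wedge ws" by (rule fin_digraph_wedge)
  let ?S = "mk_symmetric (wedge ws)"
  interpret S: pair_wf_digraph ?S by (rule wellformed_mk_symmetric)
  have sym: "symmetric ?S" by (auto simp: symmetric_def parcs_mk_symmetric intro!: symI)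
  have circle: "(0, 0) \<rightarrow>\<^sup>*\<^bsub>?S\<^esub> wedge_vertex ws i k" if "i < length ws" "k \<le> length (ws ! i)" for i k
    using that(2)
  proof (induction k)
    case 0
    then show ?case by (simp add: wedge_vertex_def)
  next
    case (Suc k)
    have "(i, k) \<in> arcs (wedge ws)" using that Suc.prems by simp
    then have "(wedge_vertex ws i k, wedge_vertex ws i (Suc k)) \<in> parcs ?S"
      unfolding parcs_mk_symmetric by (intro UN_I[of "(i, k)"]) auto
    with Suc.IH[OF Suc_leD[OF Suc.prems]] show ?case by (rule S.reachable_adj_trans)
  qed
  have base: "(0, 0) \<rightarrow>\<^sup>*\<^bsub>?S\<^esub> v" if "v \<in> verts (wedge ws)" for v
    using that by (cases rule: wedge_vertex_cases) (simp_all add: circle)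
  have "u \<rightarrow>\<^sup>*\<^bsub>?S\<^esub> v" if "u \<in> verts (wedge ws)" "v \<in> verts (wedge ws)" for u v
    using S.reachable_trans[OF symmetric_reachable[OF sym base] base] that by blast
  then show ?thesis unfolding connected_def strongly_connected_def by auto
qed

text \<open>Incidence is symmetric, so paths from a single cell \<open>c\<close> can be reversed and
  joined through \<open>c\<close>.\<close>

lemma components_connected:
  assumes "c \<in> S" "\<And>x. x \<in> S \<Longrightarrow> (c, x) \<in> (incidence G \<inter> S \<times> S)\<^sup>*"
  shows "components G S = {S}"
proof -
  have "sym (incidence G \<inter> S \<times> S)" by (auto simp: sym_def incidence_def)
  then have "sym ((incidence G \<inter> S \<times> S)\<^sup>*)" by (rule sym_rtrancl)
  then have "(x, y) \<in> (incidence G \<inter> S \<times> S)\<^sup>*" if "x \<in> S" "y \<in> S" for x y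
    using assms(2)[OF that(1)] assms(2)[OF that(2)] by (meson rtrancl_trans symD)
  then have "cell_connected G S = S \<times> S" by (auto simp: cell_connected_def)
  then show ?thesis using assms(1) by (auto simp: components_def quotient_def)
qed

text \<open>Deleting the last edge of a circle leaves an initial segment still attached at the base
  point, so going forward along the circles reaches all remaining cells. The empty \<open>E\<close>
  gives the intact wedge.\<close>

lemma components_wedge_minus_last_edges:
  assumes E: "E \<subseteq> {(i, k). Suc k = length (ws ! i)}"
  defines "S \<equiv> cells (wedge ws) - Inr ` E"
  shows "components (wedge ws) S = {S}"
proof (rule components_connected)
  let ?R = "incidence (wedge ws) \<inter> S \<times> S"
  show "Inl (0, 0) \<in> S" by (auto simp: S_def cells_def)
  have vert: "Inl (wedge_vertex ws i k) \<in> S" if "i < length ws" "k \<le> length (ws ! i)" for i k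
    using wedge_vertex_in_verts[OF that] by (auto simp: S_def cells_def)
  have inc: "(Inl (wedge_vertex ws i k), Inr (i, k)) \<in> ?R"
    "(Inr (i, k), Inl (wedge_vertex ws i (Suc k))) \<in> ?R" if "Inr (i, k) \<in> S" for i k
  proof -
    have ik: "(i, k) \<in> arcs (wedge ws)" using that by (auto simp: S_def cells_def)
    then have "(Inl (wedge_vertex ws i k), Inr (i, k)) \<in> incidence (wedge ws)"
      "(Inr (i, k), Inl (wedge_vertex ws i (Suc k))) \<in> incidence (wedge ws)"
      unfolding incidence_def by (auto intro!: bexI[of _ "(i, k)"])
    then show "(Inl (wedge_vertex ws i k), Inr (i, k)) \<in> ?R"
      "(Inr (i, k), Inl (wedge_vertex ws i (Suc k))) \<in> ?R"
      using that ik vert[of i k] vert[of i "Suc k"] by auto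
  qed
  have circle: "(Inl (0, 0), Inl (wedge_vertex ws i k)) \<in> ?R\<^sup>*"
    if "i < length ws" "k < length (ws ! i)" for i k
    using that(2)
  proof (induction k)
    case 0
    then show ?case by (simp add: wedge_vertex_def)
  next
    case (Suc k)
    \<comment> \<open>Here \<open>Suc k < length (ws ! i)\<close>, so the edge \<open>(i, k)\<close>
      is not the last one of its circle.\<close>
    then have "(i, k) \<notin> E" using E by auto
    then have "Inr (i, k) \<in> S" using that Suc.prems by (auto simp: S_def cells_def)
    from inc[OF this] show ?case
      using Suc by (blast intro: rtrancl_into_rtrancl dest: Suc_lessD)
  qed
  fix x assume x: "x \<in> S"
  show "(Inl (0, 0), x) \<in> ?R\<^sup>*"
  proof (cases x)
    case (Inl v)
    with x have "v \<in> verts (wedge ws)" by (auto simp: S_def cells_def)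
    then show ?thesis
      unfolding Inl using circle by (cases rule: wedge_vertex_cases) auto
  next
    case (Inr e)
    obtain i k where e: "e = (i, k)" by fastforce
    with x Inr have "i < length ws" "k < length (ws ! i)" by (auto simp: S_def cells_def)
    then have "(Inl (0, 0), Inl (wedge_vertex ws i k)) \<in> ?R\<^sup>*" by (rule circle)
    moreover have "(Inl (wedge_vertex ws i k), x) \<in> ?R"
      using inc(1)[of i k] x unfolding Inr e by blast
    ultimately show ?thesis by (rule rtrancl_into_rtrancl)
  qed
qed

lemma reduced_rank_wedge_minus_last_edges:
  assumes "E \<subseteq> {(i, k). Suc k = length (ws ! i)}"
  shows "reduced_rank (wedge ws) (cells (wedge ws) - Inr ` E) =
    max 0 (int (card (arcs (wedge ws) - E)) - int (card (verts (wedge ws))))"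
proof -
  have "Inl -` (cells (wedge ws) - Inr ` E) = verts (wedge ws)"
    "Inr -` (cells (wedge ws) - Inr ` E) = arcs (wedge ws) - E"
    by (auto simp: cells_def)
  then show ?thesis
    using components_wedge_minus_last_edges[OF assms] by (simp add: reduced_rank_def euler_char_def)
qed


section \<open>The fundamental group of a wedge\<close>

lemma edge_path_append:
  "edge_path G u p v \<Longrightarrow> edge_path G v q w \<Longrightarrow> edge_path G u (p @ q) w"
  by (induction G u p v rule: edge_path.induct) auto

lemma edge_path_subset_arcs: "edge_path G u p v \<Longrightarrow> fst ` set p \<subseteq> arcs G"
  by (induction G u p v rule: edge_path.induct) auto

lemma (in wf_digraph) edge_path_in_verts: "edge_path G u p v \<Longrightarrow> u \<in> verts G \<and> v \<in> verts G"
proof (induction p arbitrary: u)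
  case (Cons a p)
  then show ?case by (cases a; cases "snd a") auto
qed auto

lemma (in wf_digraph) edge_path_rev:
  "edge_path G u p v \<Longrightarrow> edge_path G v (rev (map (\<lambda>(e, s). (e, \<not> s)) p)) u"
proof (induction p arbitrary: u)
  case (Cons a p)
  then show ?case
    by (cases a; cases "snd a") (auto intro!: edge_path_append)
qed auto

text \<open>The start \<open>k\<close> is arbitrary so that induction can run backwards from the end
  of the word; \<open>k = 0\<close> gives the whole circle.\<close>

lemma edge_path_wedge_circle:
  assumes "i < length ws" "k \<le> length (ws ! i)"
  shows "edge_path (wedge ws) (wedge_vertex ws i k)
    (map (\<lambda>j. ((i, j), snd (ws ! i ! j))) [k..<length (ws ! i)]) (0, 0)"
  using assms(2)
proof (induction k rule: inc_induct)
  case base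
  then show ?case by (simp add: wedge_vertex_def)
next
  case (step k)
  then show ?case using assms(1) by (simp add: upt_conv_Cons)
qed

context group
begin

text \<open>The words read from the base point along the circles define a potential \<open>P\<close> on the
  vertices, and the label of an edge path from \<open>u\<close> to \<open>v\<close> lies in
  \<open>P(u)\<^sup>-\<^sup>1 \<langle>ws\<rangle> P(v)\<close>.\<close>

lemma wedge_path_potential:
  assumes H: "subgroup H G" and ws: "word_val G ` set ws \<subseteq> H" "\<forall>w \<in> set ws. fst ` set w \<subseteq> carrier G"
  defines "P \<equiv> \<lambda>(i, k). word_val G (take k (ws ! i))"
  assumes "edge_path (wedge ws) u p v"
  shows "\<exists>h \<in> H. P u \<otimes> word_val G (map (\<lambda>(e, s). (wedge_label ws e, s)) p) = h \<otimes> P v"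
proof -
  let ?val = "\<lambda>p. word_val G (map (\<lambda>(e, s). (wedge_label ws e, s)) p)"
  interpret W: fin_digraph "wedge ws" by (rule fin_digraph_wedge)
  have letters: "fst (ws ! i ! k) \<in> carrier G" if "i < length ws" "k < length (ws ! i)" for i k
    using ws(2) that by (meson image_subset_iff nth_mem)
  have words: "fst ` set (take k (ws ! i)) \<subseteq> carrier G" if "i < length ws" for i k
    using ws(2) nth_mem[OF that] set_take_subset[of k "ws ! i"] by blast
  have P_closed: "P x \<in> carrier G" if "x \<in> verts (wedge ws)" for x
    using that words by (auto simp: P_def)
  have P_wv: "P (wedge_vertex ws i k) \<in> carrier G" if "i < length ws" "k \<le> length (ws ! i)" for i k
    using P_closed[OF wedge_vertex_in_verts[OF that]] .
  have forward: "\<exists>h \<in> H. P (wedge_vertex ws i k) \<otimes> letter_val G (ws ! i ! k) =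
      h \<otimes> P (wedge_vertex ws i (Suc k))" if ik: "i < length ws" "k < length (ws ! i)" for i k
  proof -
    have "P (wedge_vertex ws i k) \<otimes> letter_val G (ws ! i ! k) = word_val G (take (Suc k) (ws ! i))"
      using ik words[of i k] letters[OF ik]
      by (auto simp: P_def wedge_vertex_def take_Suc_conv_app_nth word_val_append)
    \<comment> \<open>The last edge returns to the base point, where \<open>P\<close> is trivial, so
      the whole word becomes \<open>h\<close>; on every other edge \<open>h\<close> is
      \<open>\<one>\<close>.\<close>
    also have "\<exists>h \<in> H. \<dots> = h \<otimes> P (wedge_vertex ws i (Suc k))"
    proof (cases "Suc k = length (ws ! i)")
      case True
      then show ?thesis
        using ik ws(1) words[OF ik(1), of "Suc k"]
        by (intro bexI[of _ "word_val G (ws ! i)"]) (auto simp: P_def wedge_vertex_def)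
    next
      case False
      then show ?thesis
        using ik words[OF ik(1), of "Suc k"] subgroup.one_closed[OF H]
        by (intro bexI[of _ \<one>]) (auto simp: P_def wedge_vertex_def simp del: take_Suc_conv_app_nth)
    qed
    finally show ?thesis .
  qed
  \<comment> \<open>The forward relation solved for the other end, with \<open>inv h\<close> in
    place of \<open>h\<close>.\<close>
  have backward: "\<exists>h \<in> H. P (wedge_vertex ws i (Suc k)) \<otimes> inv (letter_val G (ws ! i ! k)) =
      h \<otimes> P (wedge_vertex ws i k)" if ik: "i < length ws" "k < length (ws ! i)" for i k
  proof -
    obtain h where h: "h \<in> H" "P (wedge_vertex ws i k) \<otimes> letter_val G (ws ! i ! k) =
        h \<otimes> P (wedge_vertex ws i (Suc k))" using forward[OF ik] by blast
    have c: "h \<in> carrier G" "P (wedge_vertex ws i k) \<in> carrier G"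
      "P (wedge_vertex ws i (Suc k)) \<in> carrier G" "letter_val G (ws ! i ! k) \<in> carrier G"
      using subgroup.mem_carrier[OF H h(1)] P_wv ik letters by auto
    have "P (wedge_vertex ws i (Suc k)) =
        inv h \<otimes> (P (wedge_vertex ws i k) \<otimes> letter_val G (ws ! i ! k))"
      using c by (simp add: h(2) m_assoc[symmetric])
    then have "P (wedge_vertex ws i (Suc k)) \<otimes> inv (letter_val G (ws ! i ! k)) =
        inv h \<otimes> P (wedge_vertex ws i k)"
      using c by (simp add: m_assoc)
    then show ?thesis using subgroup.m_inv_closed[OF H h(1)] by blast
  qed
  show ?thesis
    using assms(5)
  proof (induction p arbitrary: u)
    case Nil
    then show ?case
      using P_closed subgroup.one_closed[OF H] by (intro bexI[of _ \<one>]) auto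
  next
    case (Cons a p)
    obtain i k s where a: "a = ((i, k), s)" by (metis prod.exhaust)
    define u' where "u' = (if s then head (wedge ws) (i, k) else tail (wedge ws) (i, k))"
    have ik: "i < length ws" "k < length (ws ! i)" and path: "edge_path (wedge ws) u' p v"
      and u: "u = (if s then tail (wedge ws) (i, k) else head (wedge ws) (i, k))"
      using Cons.prems by (auto simp: a u'_def)
    let ?l = "letter_val G (fst (ws ! i ! k), s)"
    \<comment> \<open>If the sign of the step agrees with that of the letter, the edge is traversed
      in the reading direction of its circle, otherwise backwards.\<close>
    have "\<exists>h \<in> H. P u \<otimes> ?l = h \<otimes> P u'"
    proof (cases "s = snd (ws ! i ! k)")
      case True
      then show ?thesis using forward[OF ik] by (auto simp: u u'_def)
    next
      case False
      then have "?l = inv (letter_val G (ws ! i ! k))"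
        using letter_val_opposite[OF letters[OF ik], of "snd (ws ! i ! k)"] by simp
      with False show ?thesis using backward[OF ik] by (auto simp: u u'_def)
    qed
    then obtain h where h: "h \<in> H" "P u \<otimes> ?l = h \<otimes> P u'" by blast
    obtain h' where h': "h' \<in> H" "P u' \<otimes> ?val p = h' \<otimes> P v"
      using Cons.IH[OF path] by blast
    have u_in: "u \<in> verts (wedge ws)" "u' \<in> verts (wedge ws)" "v \<in> verts (wedge ws)"
      using W.edge_path_in_verts[OF Cons.prems] W.edge_path_in_verts[OF path] by blast+
    have "fst ` set (map (\<lambda>(e, s). (wedge_label ws e, s)) p) = wedge_label ws ` fst ` set p"
      by force
    also have "\<dots> \<subseteq> wedge_label ws ` arcs (wedge ws)"
      using edge_path_subset_arcs[OF path] by (rule image_mono)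
    also have "\<dots> \<subseteq> carrier G" using letters by (auto simp: wedge_label_def)
    finally have "fst ` set (map (\<lambda>(e, s). (wedge_label ws e, s)) p) \<subseteq> carrier G" .
    then have c: "P u \<in> carrier G" "P u' \<in> carrier G" "P v \<in> carrier G" "?l \<in> carrier G"
      "?val p \<in> carrier G" "h \<in> carrier G" "h' \<in> carrier G"
      using P_closed u_in letters[OF ik] subgroup.mem_carrier[OF H] h(1) h'(1) by auto
    have "P u \<otimes> ?val (a # p) = P u \<otimes> ?l \<otimes> ?val p"
      using c by (simp add: a wedge_label_def m_assoc)
    also have "\<dots> = h \<otimes> (P u' \<otimes> ?val p)"
      using c by (simp add: h(2) m_assoc)
    also have "\<dots> = h \<otimes> h' \<otimes> P v"
      using c by (simp add: h'(2) m_assoc)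
    finally show ?case using subgroup.m_closed[OF H h(1) h'(1)] by blast
  qed
qed

text \<open>At the base point the potential is trivial, so labels of closed paths lie in the
  generated subgroup. Conversely, the circles read the generators, reversed paths give inverses and
  concatenations give products.\<close>

lemma pi1_image_wedge:
  assumes ws: "\<forall>w \<in> set ws. fst ` set w \<subseteq> carrier G"
  shows "pi1_image G (wedge ws) (0, 0) (wedge_label ws) = generate G (word_val G ` set ws)"
    (is "?L = generate G ?V")
proof
  interpret W: fin_digraph "wedge ws" by (rule fin_digraph_wedge)
  have V: "?V \<subseteq> carrier G" using ws by auto
  let ?lab = "map (\<lambda>(e, s). (wedge_label ws e, s))"
  have lab_closed: "fst ` set (?lab p) \<subseteq> carrier G" if "edge_path (wedge ws) u p v" for u p v
  proof -
    have "fst ` set (?lab p) = wedge_label ws ` fst ` set p" by force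
    also have "\<dots> \<subseteq> wedge_label ws ` arcs (wedge ws)"
      using edge_path_subset_arcs[OF that] by (rule image_mono)
    also have "\<dots> \<subseteq> carrier G"
      using ws by (auto simp: wedge_label_def) (meson image_subset_iff nth_mem)
    finally show ?thesis .
  qed
  show "?L \<subseteq> generate G ?V"
  proof
    fix g assume "g \<in> ?L"
    then obtain p where p: "edge_path (wedge ws) (0, 0) p (0, 0)" "g = word_val G (?lab p)"
      by (auto simp: pi1_image_def)
    obtain h where h: "h \<in> generate G ?V" "\<one> \<otimes> g = h \<otimes> \<one>"
      using wedge_path_potential[OF generate_is_subgroup[OF V] _ ws p(1)] p(2)
      by (auto intro: generate.incl)
    moreover have "g \<in> carrier G" using p lab_closed by simp
    moreover have "h \<in> carrier G" using generate_in_carrier[OF V h(1)] .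
    ultimately show "g \<in> generate G ?V" by simp
  qed
  have circle: "word_val G w \<in> ?L" if w: "w \<in> set ws" for w
  proof -
    obtain i where i: "i < length ws" "w = ws ! i" using w by (metis in_set_conv_nth)
    have "?lab (map (\<lambda>j. ((i, j), snd (ws ! i ! j))) [0..<length w]) = w"
      by (rule nth_equalityI) (auto simp: wedge_label_def i)
    moreover have "edge_path (wedge ws) (0, 0) (map (\<lambda>j. ((i, j), snd (ws ! i ! j))) [0..<length w]) (0, 0)"
      using edge_path_wedge_circle[OF i(1), of 0] by (simp add: wedge_vertex_def i)
    ultimately show ?thesis unfolding pi1_image_def by force
  qed
  have inverse: "inv g \<in> ?L" if g: "g \<in> ?L" for g
  proof -
    obtain p where p: "edge_path (wedge ws) (0, 0) p (0, 0)" "g = word_val G (?lab p)"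
      using g by (auto simp: pi1_image_def)
    have "?lab (rev (map (\<lambda>(e, s). (e, \<not> s)) p)) = rev (map (\<lambda>(x, s). (x, \<not> s)) (?lab p))"
      by (auto simp: rev_map)
    then have "word_val G (?lab (rev (map (\<lambda>(e, s). (e, \<not> s)) p))) = inv g"
      using word_val_inverse[OF lab_closed[OF p(1)]] p(2) by simp
    then show ?thesis using W.edge_path_rev[OF p(1)] unfolding pi1_image_def by force
  qed
  show "generate G ?V \<subseteq> ?L"
  proof
    fix g assume "g \<in> generate G ?V"
    then show "g \<in> ?L"
    proof (induction rule: generate.induct)
      case one
      show ?case unfolding pi1_image_def by (intro CollectI exI[of _ "[]"]) simp
    next
      case (eng g h)
      then obtain p q where
        p: "edge_path (wedge ws) (0, 0) p (0, 0)" "g = word_val G (?lab p)" and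
        q: "edge_path (wedge ws) (0, 0) q (0, 0)" "h = word_val G (?lab q)"
        by (auto simp: pi1_image_def)
      have "word_val G (?lab (p @ q)) = g \<otimes> h"
        using word_val_append[OF lab_closed[OF p(1)] lab_closed[OF q(1)]] p(2) q(2) by simp
      then show ?case using edge_path_append[OF p(1) q(1)] unfolding pi1_image_def by force
    qed (use circle inverse in auto)
  qed
qed

end


section \<open>The subgroup generated by two commutators\<close>

definition commutator_words :: "'g \<Rightarrow> 'g \<Rightarrow> 'g word list" where
  "commutator_words a b =
     [[(a, True), (b, True), (a, False), (b, False)], [(a, False), (b, False), (a, True), (b, True)]]"

lemma commutator_words_wedge:
  "arcs (wedge (commutator_words a b)) = {0, 1} \<times> {0, 1, 2, 3}"
  "verts (wedge (commutator_words a b)) = insert (0, 0) ({0, 1} \<times> {1, 2, 3})"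
  by (auto simp: commutator_words_def less_Suc_eq numeral_eq_Suc)

text \<open>The base point has exactly one outgoing and one incoming edge for each of
  \<open>a\<close> and \<open>b\<close>; at every other vertex the two edges have different labels,
  as \<open>a\<close> and \<open>b\<close> alternate in the words. Hence no two edges can be
  folded.\<close>

lemma immersion_commutator_words:
  assumes "a \<noteq> b"
  shows "immersion (wedge (commutator_words a b)) (bouquet {a, b}) (\<lambda>_. ())
    (wedge_label (commutator_words a b))"
proof -
  let ?ws = "commutator_words a b"
  have "wf_digraph (wedge ?ws)"
    using fin_digraph_wedge by (rule fin_digraph.axioms(1))
  moreover have "wf_digraph (bouquet {a, b})" by unfold_locales (auto simp: bouquet_def)
  moreover have "wedge_label ?ws e \<in> {a, b}" if "e \<in> arcs (wedge ?ws)" for e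
    using that unfolding commutator_words_wedge
    by (auto simp: commutator_words_def wedge_label_def)
  moreover
  have edges: "arcs (wedge ?ws) = {(0, 0), (0, 1), (0, 2), (0, 3), (1, 0), (1, 1), (1, 2), (1, 3)}"
    unfolding commutator_words_wedge by auto
  have "\<forall>e \<in> arcs (wedge ?ws). \<forall>e' \<in> arcs (wedge ?ws). wedge_label ?ws e = wedge_label ?ws e' \<longrightarrow>
      tail (wedge ?ws) e = tail (wedge ?ws) e' \<or> head (wedge ?ws) e = head (wedge ?ws) e' \<longrightarrow> e = e'"
    unfolding edges using assms
    by (simp add: commutator_words_def wedge_label_def wedge_vertex_def)
  then have "inj_on (wedge_label ?ws) (out_arcs (wedge ?ws) v)"
    "inj_on (wedge_label ?ws) (in_arcs (wedge ?ws) v)" for v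
    by (auto simp: inj_on_def out_arcs_def in_arcs_def simp del: wedge_sel)
  ultimately show ?thesis
    by (auto simp: immersion_def graph_morphism_def bouquet_def simp del: wedge_sel(2))
qed

lemma generalized_echelon_commutator_words:
  assumes "a \<noteq> b"
  shows "generalized_echelon_immersion (wedge (commutator_words a b)) (bouquet {a, b}) (\<lambda>_. ())
    (wedge_label (commutator_words a b))"
proof -
  let ?ws = "commutator_words a b"
  \<comment> \<open>Seven vertices and eight edges give Euler characteristic -1, and removing
    \<open>(0, 3)\<close>, the last edge of the first circle, raises it to 0.\<close>
  have "maximal_essential (wedge ?ws) {(0, 3)}"
  proof -
    have "reduced_rank (wedge ?ws) (cells (wedge ?ws) - Inr ` {}) = 1"
      by (subst reduced_rank_wedge_minus_last_edges)
        (simp_all add: commutator_words_wedge card_cartesian_product del: wedge_sel(1,2))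
    moreover have "{(0, 3)} \<subseteq> {(i, k). Suc k = length (?ws ! i)}"
      by (simp add: commutator_words_def)
    then have "reduced_rank (wedge ?ws) (cells (wedge ?ws) - Inr ` {(0, 3)}) = 0"
      by (subst reduced_rank_wedge_minus_last_edges)
        (simp_all add: commutator_words_wedge card_cartesian_product del: wedge_sel(1,2))
    ultimately show ?thesis
      by (simp add: maximal_essential_def essential_def commutator_words_wedge del: wedge_sel(1,2))
  qed
  then have "maximal_essential (wedge ?ws) (set [(0, 3)])" by simp
  then show ?thesis
    unfolding generalized_echelon_immersion_def
    using fin_digraph_wedge immersion_commutator_words[OF assms]
    by (intro conjI exI[of _ "[(0, 3)]"]) auto
qed

theorem mainTheorem4:
  fixes F :: "('g, 'r) monoid_scheme" (structure) and a b :: 'g and H :: "'g set"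
  assumes "free_basis F {a, b}" and "a \<noteq> b"
    and "H = generate F {a \<otimes> b \<otimes> inv a \<otimes> inv b, inv a \<otimes> inv b \<otimes> a \<otimes> b}"
  shows "generalized_echelon_subgroup F {a, b} H \<and> \<not> echelon_subgroup F H"
proof
  interpret group F using assms(1) by (simp add: free_basis_def)
  have ab: "a \<in> carrier F" "b \<in> carrier F" using assms(1) by (auto simp: free_basis_def)
  let ?c = "a \<otimes> b \<otimes> inv a \<otimes> inv b" and ?d = "inv a \<otimes> inv b \<otimes> a \<otimes> b"
  let ?ws = "commutator_words a b"
  have vals: "word_val F ` set ?ws = {?c, ?d}"
    using ab by (simp add: commutator_words_def letter_val_def m_assoc)
  have red: "set ?ws \<subseteq> reduced_words {a, b}"
    using assms(2) by (auto simp: commutator_words_def reduced_words_def reduced_def)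
  have "pi1_image F (wedge ?ws) (0, 0) (wedge_label ?ws) = H"
    unfolding assms(3) vals[symmetric]
    using ab by (intro pi1_image_wedge) (auto simp: commutator_words_def)
  \<comment> \<open>The wedge itself is the representing graph, with an empty sequence of
    foldings.\<close>
  then have "represents F {a, b} H (wedge ?ws) (0, 0) (wedge_label ?ws)"
    unfolding represents_def
    using fin_digraph_wedge[of ?ws] connected_wedge[of ?ws] immersion_commutator_words[OF assms(2)]
      red vals assms(3)
    by (intro conjI exI[of _ ?ws]) auto
  with generalized_echelon_commutator_words[OF assms(2)]
  show "generalized_echelon_subgroup F {a, b} H"
    unfolding generalized_echelon_subgroup_def by blast

  have "{?c, ?d} \<subseteq> H" unfolding assms(3) by (auto intro: generate.incl)
  then have cd: "?c \<in> H" "?d \<in> H" by auto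
  have "?c \<otimes> ?d \<noteq> ?d \<otimes> ?c"
  proof
    \<comment> \<open>Both products are read by concatenations that remain reduced and differ in
      their first letter, so uniqueness of reduced words separates them.\<close>
    let ?u = "?ws ! 0 @ ?ws ! 1" and ?v = "?ws ! 1 @ ?ws ! 0"
    assume "?c \<otimes> ?d = ?d \<otimes> ?c"
    then have "word_val F ?u = word_val F ?v"
      using ab by (simp add: commutator_words_def letter_val_def m_assoc)
    moreover have "?u \<in> reduced_words {a, b}" "?v \<in> reduced_words {a, b}"
      using assms(2) by (auto simp: commutator_words_def reduced_words_def reduced_def)
    ultimately have "?u = ?v"
      using reduced_word_of_word_val[OF assms(1)] by metis
    then show False by (simp add: commutator_words_def)
  qed
  \<comment> \<open>In each generator \<open>a\<close> and \<open>b\<close> occur once with each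
    sign, so their contributions cancel whatever basis \<open>X\<close> is used.\<close>
  moreover have "H \<subseteq> {g \<in> carrier F. exponent_sum F X f g = 0}" if "free_basis F X" for X f
    unfolding assms(3) using exponent_sum_eq_0_subgroup[OF that]
  proof (rule generate_subgroup_incl[rotated])
    show "{?c, ?d} \<subseteq> {g \<in> carrier F. exponent_sum F X f g = 0}"
      using ab by (simp add: exponent_sum_mult[OF that] exponent_sum_inv[OF that])
  qed
  ultimately show "\<not> echelon_subgroup F H"
    using not_echelon_subgroup[OF assms(1) _ cd] by blast
qed

end
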